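(* For every finite set $X$, the internal coproduct $\Gamma$ and the external coproduct $\Delta$ on $\mathbb T_X$ satisfy $$(I\otimes\Delta)\circ\Gamma=m^{1,3}\circ(\Gamma\otimes\Gamma)\circ\Delta$$ as maps $\mathbb T_X\to\bigoplus_{Y\subset X}\mathbb T_X\otimes\mathbb T_{X\setminus Y}\otimes\mathbb T_Y$, where $m^{1,3}:\mathbb T_{X\setminus Y}\otimes\mathbb T_{X\setminus Y}\otimes\mathbb T_Y\otimes\mathbb T_Y\to\mathbb T_X\otimes\mathbb T_{X\setminus Y}\otimes\mathbb T_Y$ is $a\otimes b\otimes c\otimes d\mapsto ac\otimes b\otimes d$.
   Context: For a finite set $X$, $\mathbb T_X$ is the vector space freely generated by topologies on $X$. Product: for disjoint $X_1,X_2$, $\mathcal T_1\mathcal T_2$ is the topology on $X_1\sqcup X_2$ with $Y$ open iff $Y\cap X_i\in\mathcal T_i$ for $i=1,2$. For $Y\subset X$, $\mathcal T|_Y=\{Z\cap Y:Z\in\mathcal T\}$. External coproduct: $\Delta(\mathcal T)=\sum_{Y\in\mathcal T}\mathcal T|_{X\setminus Y}\otimes\mathcal T|_Y$. For a topology $\mathcal T$, $x\le_{\mathcal T}y$ iff every open set containing $x$ contains $y$ (open sets = final segments); $x\sim_{\mathcal T}y$ iff $x\le_{\mathcal T}y\le_{\mathcal T}x$. $\mathcal T'\prec\mathcal T$ means every $\mathcal T$-open set is $\mathcal T'$-open. For $\mathcal T'\prec\mathcal T$, $\mathcal T/\mathcal T'$ is the topology on $X$ whose quasi-order is the transitive closure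 of $x\,\mathcal R\,y\iff(x\le_{\mathcal T}y\text{ or }y\le_{\mathcal T'}x)$. $Y$ is $\mathcal T$-connected if $(Y,\mathcal T|_Y)$ is connected. $\mathcal T'$ is $\mathcal T$-admissible if $\mathcal T'\prec\mathcal T$, $\mathcal T'|_Y=\mathcal T|_Y$ for all $\mathcal T'$-connected $Y$, and $x\sim_{\mathcal T/\mathcal T'}y\iff x\sim_{\mathcal T'/\mathcal T'}y$. Internal coproduct: $\Gamma(\mathcal T)=\sum_{\mathcal T'\ \mathcal T\text{-admissible}}\mathcal T'\otimes\mathcal T/\mathcal T'$ (on $\mathbb T_{X\setminus Y}$ and $\mathbb T_Y$, $\Gamma$ is defined in the same way). *)

theory Defs
  imports "HOL-Analysis.Abstract_Topology" "HOL-Library.Poly_Mapping"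
begin

section \<open>Free vector spaces and their tensor products\<close>

text \<open>
  The vector space freely generated by a set \<open>B\<close> is the space of finitely supported functions
  with support in \<open>B\<close>. The tensor product of the spaces generated by \<open>B\<close> and \<open>C\<close> is the space
  generated by \<open>B \<times> C\<close>, the pair \<open>(b, c)\<close> standing for the tensor of \<open>b\<close> and \<open>c\<close>.
\<close>

definition free_on :: "'b set \<Rightarrow> ('b \<Rightarrow>\<^sub>0 'k::field) set" where
  "free_on B = {v. Poly_Mapping.keys v \<subseteq> B}"

definition fscale :: "'k::field \<Rightarrow> ('b \<Rightarrow>\<^sub>0 'k) \<Rightarrow> ('b \<Rightarrow>\<^sub>0 'k)" where
  "fscale c v = Poly_Mapping.map ((*) c) v"

definition basis_vec :: "'b \<Rightarrow> ('b \<Rightarrow>\<^sub>0 'k::field)" where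
  "basis_vec b = Poly_Mapping.single b 1"

definition lin_extend :: "('b \<Rightarrow> ('c \<Rightarrow>\<^sub>0 'k::field)) \<Rightarrow> ('b \<Rightarrow>\<^sub>0 'k) \<Rightarrow> ('c \<Rightarrow>\<^sub>0 'k)" where
  "lin_extend f v = (\<Sum>b\<in>Poly_Mapping.keys v. fscale (Poly_Mapping.lookup v b) (f b))"

definition tensor :: "('b \<Rightarrow>\<^sub>0 'k::field) \<Rightarrow> ('c \<Rightarrow>\<^sub>0 'k) \<Rightarrow> ('b \<times> 'c \<Rightarrow>\<^sub>0 'k)" where
  "tensor v w = lin_extend (\<lambda>b. lin_extend (\<lambda>c. basis_vec (b, c)) w) v"

definition tensor_map ::
  "(('b \<Rightarrow>\<^sub>0 'k::field) \<Rightarrow> ('d \<Rightarrow>\<^sub>0 'k)) \<Rightarrow> (('c \<Rightarrow>\<^sub>0 'k) \<Rightarrow> ('e \<Rightarrow>\<^sub>0 'k))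
    \<Rightarrow> ('b \<times> 'c \<Rightarrow>\<^sub>0 'k) \<Rightarrow> ('d \<times> 'e \<Rightarrow>\<^sub>0 'k)" where
  "tensor_map f g = lin_extend (\<lambda>(b, c). tensor (f (basis_vec b)) (g (basis_vec c)))"

lemma lookup_fscale [simp]: "Poly_Mapping.lookup (fscale c v) b = c * Poly_Mapping.lookup v b"
  by (simp add: fscale_def Poly_Mapping.map.rep_eq when_def)

lemma vector_space_fscale: "vector_space (fscale :: 'k::field \<Rightarrow> ('b \<Rightarrow>\<^sub>0 'k) \<Rightarrow> _)"
  by unfold_locales (auto intro!: poly_mapping_eqI simp: lookup_add algebra_simps)

lemma lin_extend_superset:
  assumes "finite A" "Poly_Mapping.keys v \<subseteq> A"
  shows "lin_extend f v = (\<Sum>b\<in>A. fscale (Poly_Mapping.lookup v b) (f b))"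
  unfolding lin_extend_def
  by (rule sum.mono_neutral_left) (use assms in \<open>auto simp: in_keys_iff intro!: poly_mapping_eqI\<close>)

lemma linear_lin_extend: "Vector_Spaces.linear fscale fscale (lin_extend f)"
proof -
  have 1: "lin_extend f (v + w) = lin_extend f v + lin_extend f w" for v w
  proof -
    let ?A = "Poly_Mapping.keys v \<union> Poly_Mapping.keys w"
    have "lin_extend f (v + w) = (\<Sum>b\<in>?A. fscale (Poly_Mapping.lookup (v + w) b) (f b))"
      by (rule lin_extend_superset) (simp_all add: keys_add)
    also have "\<dots> = (\<Sum>b\<in>?A. fscale (Poly_Mapping.lookup v b) (f b))
                  + (\<Sum>b\<in>?A. fscale (Poly_Mapping.lookup w b) (f b))"
      by (subst sum.distrib[symmetric], rule sum.cong)
         (auto intro!: poly_mapping_eqI simp: lookup_add algebra_simps)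
    also have "\<dots> = lin_extend f v + lin_extend f w"
      by (simp add: lin_extend_superset[of ?A])
    finally show ?thesis .
  qed
  have 2: "lin_extend f (fscale c v) = fscale c (lin_extend f v)" for c v
  proof -
    have "lin_extend f (fscale c v)
        = (\<Sum>b\<in>Poly_Mapping.keys v. fscale (Poly_Mapping.lookup (fscale c v) b) (f b))"
      by (rule lin_extend_superset) (auto simp: in_keys_iff)
    then show ?thesis
      by (auto intro!: poly_mapping_eqI simp: lin_extend_def lookup_sum sum_distrib_left mult.assoc)
  qed
  show ?thesis
    by (simp add: Vector_Spaces.linear_iff vector_space_fscale 1 2)
qed

lemma lin_extend_basis_vec [simp]: "lin_extend f (basis_vec b) = f b"
  by (auto simp: lin_extend_def basis_vec_def intro!: poly_mapping_eqI)

lemma lin_extend_basis_vec_id: "lin_extend basis_vec v = v"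
  by (rule poly_mapping_eqI)
     (auto simp: lin_extend_def basis_vec_def lookup_sum lookup_single when_def in_keys_iff
        if_distrib[of "(*) _"] sum.delta cong: if_cong)

lemma linear_comp_lin_extend:
  assumes "Vector_Spaces.linear fscale fscale h"
  shows "h (lin_extend f v) = lin_extend (\<lambda>b. h (f b)) v"
proof -
  interpret Vector_Spaces.linear fscale fscale h by fact
  show ?thesis by (simp add: lin_extend_def sum scale)
qed

lemma linear_eq_lin_extend:
  assumes "Vector_Spaces.linear fscale fscale h"
  shows "h v = lin_extend (\<lambda>b. h (basis_vec b)) v"
  using linear_comp_lin_extend[OF assms, of basis_vec v] by (simp add: lin_extend_basis_vec_id)

lemma linear_tensor_left: "Vector_Spaces.linear fscale fscale (\<lambda>v. tensor v w)"
  unfolding tensor_def by (rule linear_lin_extend)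

lemma linear_tensor_right:
  fixes v :: "'b \<Rightarrow>\<^sub>0 'k::field"
  shows "Vector_Spaces.linear fscale fscale (tensor v :: ('c \<Rightarrow>\<^sub>0 'k) \<Rightarrow> _)"
proof -
  interpret L: Vector_Spaces.linear fscale fscale "lin_extend (\<lambda>c. basis_vec (b, c))" for b
    by (rule linear_lin_extend)
  have "tensor v (x + y) = tensor v x + tensor v y" for x y :: "'c \<Rightarrow>\<^sub>0 'k"
    by (rule poly_mapping_eqI)
       (simp add: tensor_def lin_extend_def[of _ v] L.add lookup_sum lookup_add algebra_simps sum.distrib)
  moreover have "tensor v (fscale c x) = fscale c (tensor v x)" for c and x :: "'c \<Rightarrow>\<^sub>0 'k"
    by (rule poly_mapping_eqI)
       (simp add: tensor_def lin_extend_def[of _ v] L.scale lookup_sum algebra_simps sum_distrib_left)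
  ultimately show ?thesis
    by (simp add: Vector_Spaces.linear_iff vector_space_fscale)
qed

lemma tensor_map_tensor:
  assumes f: "Vector_Spaces.linear fscale fscale f" and g: "Vector_Spaces.linear fscale fscale g"
  shows "tensor_map f g (tensor v w) = tensor (f v) (g w)"
proof -
  have "tensor_map f g (tensor v w)
      = lin_extend (\<lambda>b. lin_extend (\<lambda>c. tensor (f (basis_vec b)) (g (basis_vec c))) w) v"
    by (simp add: tensor_def[of v] tensor_map_def linear_comp_lin_extend[OF linear_lin_extend])
  also have "\<dots> = lin_extend (\<lambda>b. tensor (f (basis_vec b)) (g w)) v"
    by (simp add: linear_comp_lin_extend[OF linear_tensor_right] linear_eq_lin_extend[OF g, of w])
  also have "\<dots> = tensor (f v) (g w)"
    by (simp add: linear_comp_lin_extend[OF linear_tensor_left] linear_eq_lin_extend[OF f, of v])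
  finally show ?thesis .
qed


section \<open>Finite topologies\<close>

definition topologies_on :: "'a set \<Rightarrow> 'a topology set" where
  "topologies_on X = {T. topspace T = X}"

definition top_prod :: "'a topology \<Rightarrow> 'a topology \<Rightarrow> 'a topology" where
  "top_prod T1 T2 = topology (\<lambda>U. U \<subseteq> topspace T1 \<union> topspace T2 \<and>
     openin T1 (U \<inter> topspace T1) \<and> openin T2 (U \<inter> topspace T2))"

definition top_le :: "'a topology \<Rightarrow> 'a \<Rightarrow> 'a \<Rightarrow> bool" where
  "top_le T x y \<longleftrightarrow> x \<in> topspace T \<and> y \<in> topspace T \<and> (\<forall>U. openin T U \<and> x \<in> U \<longrightarrow> y \<in> U)"

definition top_equiv :: "'a topology \<Rightarrow> 'a \<Rightarrow> 'a \<Rightarrow> bool" where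
  "top_equiv T x y \<longleftrightarrow> top_le T x y \<and> top_le T y x"

definition top_finer :: "'a topology \<Rightarrow> 'a topology \<Rightarrow> bool" where
  "top_finer T' T \<longleftrightarrow> topspace T' = topspace T \<and> (\<forall>U. openin T U \<longrightarrow> openin T' U)"

definition quot_le :: "'a topology \<Rightarrow> 'a topology \<Rightarrow> 'a \<Rightarrow> 'a \<Rightarrow> bool" where
  "quot_le T T' = (\<lambda>x y. top_le T x y \<or> top_le T' y x)\<^sup>+\<^sup>+"

text \<open>The topology with quasi-order \<^term>\<open>quot_le T T'\<close>: its open sets are the final segments.\<close>

definition top_quot :: "'a topology \<Rightarrow> 'a topology \<Rightarrow> 'a topology" where
  "top_quot T T' = topology (\<lambda>U. U \<subseteq> topspace T \<and> (\<forall>x\<in>U. \<forall>y. quot_le T T' x y \<longrightarrow> y \<in> U))"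

definition admissible :: "'a topology \<Rightarrow> 'a topology \<Rightarrow> bool" where
  "admissible T T' \<longleftrightarrow> top_finer T' T \<and>
     (\<forall>Y. connectedin T' Y \<longrightarrow> subtopology T' Y = subtopology T Y) \<and>
     (\<forall>x\<in>topspace T. \<forall>y\<in>topspace T.
        top_equiv (top_quot T T') x y \<longleftrightarrow> top_equiv (top_quot T' T') x y)"

lemma openin_top_prod:
  "openin (top_prod T1 T2) U \<longleftrightarrow> U \<subseteq> topspace T1 \<union> topspace T2 \<and>
     openin T1 (U \<inter> topspace T1) \<and> openin T2 (U \<inter> topspace T2)"
proof -
  have "istopology (\<lambda>U. U \<subseteq> topspace T1 \<union> topspace T2 \<and>
     openin T1 (U \<inter> topspace T1) \<and> openin T2 (U \<inter> topspace T2))"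
    unfolding istopology_def
  proof (intro conjI allI impI)
    fix S T
    assume S: "S \<subseteq> topspace T1 \<union> topspace T2 \<and> openin T1 (S \<inter> topspace T1) \<and> openin T2 (S \<inter> topspace T2)"
      and T: "T \<subseteq> topspace T1 \<union> topspace T2 \<and> openin T1 (T \<inter> topspace T1) \<and> openin T2 (T \<inter> topspace T2)"
    have eq: "S \<inter> T \<inter> A = (S \<inter> A) \<inter> (T \<inter> A)" for A
      by blast
    show "S \<inter> T \<subseteq> topspace T1 \<union> topspace T2"
      using S by blast
    show "openin T1 (S \<inter> T \<inter> topspace T1)" "openin T2 (S \<inter> T \<inter> topspace T2)"
      unfolding eq using S T by (simp_all add: openin_Int)
  next
    fix K
    assume K: "\<forall>S\<in>K. S \<subseteq> topspace T1 \<union> topspace T2 \<and> openin T1 (S \<inter> topspace T1) \<and> openin T2 (S \<inter> topspace T2)"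
    show "\<Union> K \<subseteq> topspace T1 \<union> topspace T2"
      using K by blast
    show "openin T1 (\<Union> K \<inter> topspace T1)" "openin T2 (\<Union> K \<inter> topspace T2)"
      unfolding Int_Union2 using K by (blast intro: openin_Union)+
  qed
  then show ?thesis
    by (simp add: top_prod_def topology_inverse')
qed

lemma topspace_top_prod [simp]: "topspace (top_prod T1 T2) = topspace T1 \<union> topspace T2"
proof (rule equalityI)
  show "topspace (top_prod T1 T2) \<subseteq> topspace T1 \<union> topspace T2"
    using openin_topspace[of "top_prod T1 T2"] by (simp only: openin_top_prod)
  show "topspace T1 \<union> topspace T2 \<subseteq> topspace (top_prod T1 T2)"
    by (rule openin_subset) (simp add: openin_top_prod Int_absorb1)
qed

lemma openin_top_quot:
  "openin (top_quot T T') U \<longleftrightarrow>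
     U \<subseteq> topspace T \<and> (\<forall>x\<in>U. \<forall>y. quot_le T T' x y \<longrightarrow> y \<in> U)"
proof -
  have "istopology (\<lambda>U. U \<subseteq> topspace T \<and> (\<forall>x\<in>U. \<forall>y. quot_le T T' x y \<longrightarrow> y \<in> U))"
    unfolding istopology_def by blast
  then show ?thesis
    by (simp add: top_quot_def topology_inverse')
qed

lemma quot_le_topspace:
  assumes "topspace T' = topspace T" "quot_le T T' x y"
  shows "x \<in> topspace T \<and> y \<in> topspace T"
  using assms(2) unfolding quot_le_def
  by (induction rule: tranclp_induct) (auto simp: top_le_def assms(1))

lemma topspace_top_quot:
  assumes "topspace T' = topspace T"
  shows "topspace (top_quot T T') = topspace T"
proof (rule equalityI)
  show "topspace (top_quot T T') \<subseteq> topspace T"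
    using openin_topspace[of "top_quot T T'"] by (simp only: openin_top_quot)
  show "topspace T \<subseteq> topspace (top_quot T T')"
    by (rule openin_subset) (use quot_le_topspace[OF assms] in \<open>auto simp: openin_top_quot\<close>)
qed

lemma top_le_top_quot:
  assumes "topspace T' = topspace T"
  shows "top_le (top_quot T T') = quot_le T T'"
proof (intro ext iffI)
  fix x y
  assume le: "top_le (top_quot T T') x y"
  then have x: "x \<in> topspace T"
    by (simp add: top_le_def topspace_top_quot[OF assms])
  have "openin (top_quot T T') {z. quot_le T T' x z}"
    using quot_le_topspace[OF assms] by (auto simp: openin_top_quot quot_le_def)
  moreover have "quot_le T T' x x"
    using x by (auto simp: quot_le_def top_le_def)
  ultimately show "quot_le T T' x y"
    using le by (auto simp: top_le_def)
next
  fix x y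
  assume "quot_le T T' x y"
  then show "top_le (top_quot T T') x y"
    using quot_le_topspace[OF assms] by (auto simp: top_le_def topspace_top_quot[OF assms] openin_top_quot)
qed

lemma finite_topologies_on:
  assumes "finite X"
  shows "finite (topologies_on X)"
proof (rule finite_imageD)
  show "finite ((\<lambda>T. {U. openin T U}) ` topologies_on X)"
    by (rule finite_subset[of _ "Pow (Pow X)"])
       (use assms openin_subset in \<open>auto simp: topologies_on_def\<close>)
  show "inj_on (\<lambda>T. {U. openin T U}) (topologies_on X)"
    by (auto simp: inj_on_def topology_eq)
qed

section \<open>The coproducts\<close>

abbreviation TT :: "'a set \<Rightarrow> ('a topology \<Rightarrow>\<^sub>0 'k::field) set" where
  "TT X \<equiv> free_on (topologies_on X)"

definition ext_coprod ::
  "('a topology \<Rightarrow>\<^sub>0 'k::field) \<Rightarrow> ('a topology \<times> 'a topology \<Rightarrow>\<^sub>0 'k)" where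
  "ext_coprod = lin_extend (\<lambda>T. \<Sum>Y | openin T Y.
     tensor (basis_vec (subtopology T (topspace T - Y))) (basis_vec (subtopology T Y)))"

definition int_coprod ::
  "('a topology \<Rightarrow>\<^sub>0 'k::field) \<Rightarrow> ('a topology \<times> 'a topology \<Rightarrow>\<^sub>0 'k)" where
  "int_coprod = lin_extend (\<lambda>T. \<Sum>T' | admissible T T'.
     tensor (basis_vec T') (basis_vec (top_quot T T')))"

definition m13 ::
  "(('a topology \<times> 'a topology) \<times> ('a topology \<times> 'a topology) \<Rightarrow>\<^sub>0 'k::field)
    \<Rightarrow> ('a topology \<times> 'a topology \<times> 'a topology \<Rightarrow>\<^sub>0 'k)" where
  "m13 = lin_extend (\<lambda>((a, b), (c, d)). 
     tensor (basis_vec (top_prod a c)) (tensor (basis_vec b) (basis_vec d)))"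

text \<open>
  The direct sum over \<open>Y \<subseteq> X\<close> of the triple tensor products. As a topology determines its
  underlying set, the bases of the summands are pairwise disjoint, so the direct sum is the space
  generated by their union.
\<close>

definition triple_sum ::
  "'a set \<Rightarrow> ('a topology \<times> 'a topology \<times> 'a topology \<Rightarrow>\<^sub>0 'k::field) set" where
  "triple_sum X = free_on (\<Union>Y\<in>Pow X.
     topologies_on X \<times> topologies_on (X - Y) \<times> topologies_on Y)"

end

theory Submission
  imports Defs
begin

text \<open>
  A subset \<open>Y\<close> is open in \<open>T/T'\<close> iff it is open in \<open>T\<close> and clopen in \<open>T'\<close>, so that \<open>T'\<close> is
  the product of its restrictions to \<open>X - Y\<close> and \<open>Y\<close>. A chain of the relation generating \<open>T/T'\<close>
  which starts in such a \<open>Y\<close>, or ends outside of it, never crosses its boundary; hence forming the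
  quotient commutes with restriction to \<open>Y\<close> and to \<open>X - Y\<close>, and admissibility of \<open>T'\<close> can be
  tested on the two parts separately. Therefore \<open>(T', Y) \<mapsto> (Y, T'|X - Y, T'|Y)\<close> is a bijection
  between the index sets of the two sides which matches the summands.
\<close>

section \<open>Linear extensions\<close>

lemma lin_extend_sum: "lin_extend f (\<Sum>i\<in>A. g i) = (\<Sum>i\<in>A. lin_extend f (g i))"
proof -
  interpret Vector_Spaces.linear fscale fscale "lin_extend f" by (rule linear_lin_extend)
  show ?thesis by (rule sum)
qed

text \<open>Collapses a composite of linear extensions into a single one, so that an identity
  between composites only has to be checked on basis vectors.\<close>

lemma lin_extend_lin_extend: "lin_extend f (lin_extend g v) = lin_extend (\<lambda>b. lin_extend f (g b)) v"
  by (rule linear_comp_lin_extend[OF linear_lin_extend])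

lemma lin_extend_cong:
  assumes "\<And>b. b \<in> Poly_Mapping.keys v \<Longrightarrow> f b = g b"
  shows "lin_extend f v = lin_extend g v"
  unfolding lin_extend_def by (rule sum.cong) (simp_all add: assms)

lemma tensor_basis_vec [simp]: "tensor (basis_vec b) (basis_vec c) = basis_vec (b, c)"
  by (simp add: tensor_def)

lemma tensor_sum_left: "tensor (\<Sum>i\<in>A. f i) w = (\<Sum>i\<in>A. tensor (f i) w)"
proof -
  interpret Vector_Spaces.linear fscale fscale "\<lambda>v. tensor v w" by (rule linear_tensor_left)
  show ?thesis by (rule sum)
qed

lemma tensor_sum_right: "tensor v (\<Sum>i\<in>A. f i) = (\<Sum>i\<in>A. tensor v (f i))"
proof -
  interpret Vector_Spaces.linear fscale fscale "tensor v" by (rule linear_tensor_right)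
  show ?thesis by (rule sum)
qed

lemma tensor_sum: "tensor (\<Sum>i\<in>A. f i) (\<Sum>j\<in>B. g j) = (\<Sum>i\<in>A. \<Sum>j\<in>B. tensor (f i) (g j))"
  unfolding tensor_sum_left by (simp only: tensor_sum_right)

lemma free_on_sum:
  assumes "\<And>i. i \<in> A \<Longrightarrow> f i \<in> free_on B"
  shows "(\<Sum>i\<in>A. f i) \<in> free_on B"
  using assms keys_sum[of f A] by (fastforce simp: free_on_def)

lemma free_on_lin_extend:
  assumes "\<And>b. b \<in> Poly_Mapping.keys v \<Longrightarrow> f b \<in> free_on B"
  shows "lin_extend f v \<in> free_on B"
  unfolding lin_extend_def
proof (rule free_on_sum)
  fix b assume "b \<in> Poly_Mapping.keys v"
  from assms[OF this] show "fscale (Poly_Mapping.lookup v b) (f b) \<in> free_on B"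
    by (auto simp: free_on_def in_keys_iff)
qed

lemma basis_vec_in_free_on: "b \<in> B \<Longrightarrow> basis_vec b \<in> free_on B"
  by (simp add: basis_vec_def free_on_def)

section \<open>Quasi-orders of finite topologies\<close>

text \<open>In a finite space the intersection of all open neighbourhoods of a point is open, and it
  consists of the points above that point. Hence the quasi-order determines the topology.\<close>

lemma openin_iff_top_le:
  assumes "finite (topspace T)"
  shows "openin T U \<longleftrightarrow> U \<subseteq> topspace T \<and> (\<forall>x\<in>U. \<forall>y. top_le T x y \<longrightarrow> y \<in> U)"
proof
  assume "openin T U"
  then show "U \<subseteq> topspace T \<and> (\<forall>x\<in>U. \<forall>y. top_le T x y \<longrightarrow> y \<in> U)"
    using openin_subset by (auto simp: top_le_def)
next
  assume U: "U \<subseteq> topspace T \<and> (\<forall>x\<in>U. \<forall>y. top_le T x y \<longrightarrow> y \<in> U)"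
  show "openin T U"
  proof (subst openin_subopen, intro ballI)
    fix x assume x: "x \<in> U"
    let ?K = "{V. openin T V \<and> x \<in> V}"
    have "finite ?K"
      by (rule finite_subset[of _ "Pow (topspace T)"]) (use assms openin_subset in auto)
    \<comment> \<open>\<open>openin_Inter\<close> needs a nonempty family. The same member also
      places the points of the intersection in the space, as \<open>top_le\<close> demands.\<close>
    moreover have "topspace T \<in> ?K"
      using x U by auto
    ultimately have "openin T (\<Inter>?K)"
      by (intro openin_Inter) auto
    moreover have "\<Inter>?K \<subseteq> U"
    proof
      fix y assume "y \<in> \<Inter>?K"
      then have "top_le T x y"
        using x U \<open>topspace T \<in> ?K\<close> unfolding top_le_def by blast
      then show "y \<in> U" using U x by blast
    qed
    ultimately show "\<exists>V. openin T V \<and> x \<in> V \<and> V \<subseteq> U"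
      by blast
  qed
qed

lemma top_le_subtopology:
  "top_le (subtopology T Z) x y \<longleftrightarrow> x \<in> Z \<and> y \<in> Z \<and> top_le T x y"
  by (auto simp: top_le_def openin_subtopology)

lemma top_equiv_subtopology:
  "top_equiv (subtopology T Z) x y \<longleftrightarrow> x \<in> Z \<and> y \<in> Z \<and> top_equiv T x y"
  by (auto simp: top_equiv_def top_le_subtopology)

lemma top_finer_top_le: "top_finer T' T \<Longrightarrow> top_le T' x y \<Longrightarrow> top_le T x y"
  by (auto simp: top_finer_def top_le_def)

lemma top_finer_subtopology: "top_finer T' T \<Longrightarrow> top_finer (subtopology T' Z) (subtopology T Z)"
  by (auto simp: top_finer_def openin_subtopology)

text \<open>A set closed under \<open>R\<close> traps every chain that starts in it, so the chain
  can be replayed inside the set. This serves the open sets of a quotient.\<close>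

lemma tranclp_restrict_closed:
  assumes "R\<^sup>+\<^sup>+ x y" "x \<in> Z" and closed: "\<And>x y. R x y \<Longrightarrow> x \<in> Z \<Longrightarrow> y \<in> Z"
  shows "(\<lambda>x y. R x y \<and> x \<in> Z \<and> y \<in> Z)\<^sup>+\<^sup>+ x y \<and> y \<in> Z"
  using assms(1,2)
proof (induction rule: tranclp_induct)
  case (base y)
  then show ?case using closed by blast
next
  case (step y z)
  then have "R y z \<and> y \<in> Z \<and> z \<in> Z" using closed by blast
  with step show ?case by (auto intro: tranclp.trancl_into_trancl)
qed

text \<open>The dual for complements of open sets: these are closed under going backwards, so the
  induction runs from the end of the chain.\<close>

lemma tranclp_restrict_coclosed:
  assumes "R\<^sup>+\<^sup>+ x y" "y \<in> Z" and closed: "\<And>x y. R x y \<Longrightarrow> y \<in> Z \<Longrightarrow> x \<in> Z"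
  shows "(\<lambda>x y. R x y \<and> x \<in> Z \<and> y \<in> Z)\<^sup>+\<^sup>+ x y \<and> x \<in> Z"
  using assms(1,2)
proof (induction rule: converse_tranclp_induct)
  case (base x)
  then show ?case using closed by blast
next
  case (step x z)
  then have "R x z \<and> x \<in> Z \<and> z \<in> Z" using closed by blast
  with step show ?case by (auto intro: tranclp_into_tranclp2)
qed

section \<open>Open sets of a quotient\<close>

text \<open>Closure under single steps propagates along chains; this removes the transitive closure
  from later arguments about open sets.\<close>

lemma openin_top_quot_step:
  assumes "topspace T' = topspace T"
  shows "openin (top_quot T T') U \<longleftrightarrow>
    U \<subseteq> topspace T \<and> (\<forall>x\<in>U. \<forall>y. top_le T x y \<or> top_le T' y x \<longrightarrow> y \<in> U)"
    (is "_ \<longleftrightarrow> ?R")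
proof
  assume "openin (top_quot T T') U"
  then show ?R
    unfolding openin_top_quot quot_le_def by blast
next
  assume R: ?R
  have "y \<in> U" if "quot_le T T' x y" "x \<in> U" for x y
    using tranclp_restrict_closed[OF that[unfolded quot_le_def]] R by blast
  with R show "openin (top_quot T T') U"
    unfolding openin_top_quot by blast
qed

text \<open>For an arbitrary \<open>Z\<close>, a chain between two points of \<open>Z\<close> might
  have to leave \<open>Z\<close>. Here it cannot: a chain starting in \<open>U\<close> stays in
  \<open>U\<close>, and one ending outside \<open>U\<close> was never in it. The variable
  \<open>Z\<close> treats both parts at once.\<close>

lemma quot_le_subtopology:
  assumes sp: "topspace T' = topspace T"
    and U: "openin (top_quot T T') U" and Z: "Z = U \<or> Z = topspace T - U"
  shows "quot_le (subtopology T Z) (subtopology T' Z) x y \<longleftrightarrow> x \<in> Z \<and> y \<in> Z \<and> quot_le T T' x y"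
proof -
  let ?R = "\<lambda>x y. top_le T x y \<or> top_le T' y x"
  \<comment> \<open>Restricting both topologies restricts the generating relation; what remains is
    to compare the transitive closures.\<close>
  have eq: "quot_le (subtopology T Z) (subtopology T' Z) = (\<lambda>x y. ?R x y \<and> x \<in> Z \<and> y \<in> Z)\<^sup>+\<^sup>+"
    unfolding quot_le_def top_le_subtopology by (rule arg_cong[of _ _ tranclp]) (intro ext, blast)
  have closed: "y \<in> U" if "?R x y" "x \<in> U" for x y
    using U that unfolding openin_top_quot_step[OF sp] by blast
  have sub: "x \<in> topspace T \<and> y \<in> topspace T" if "?R x y" for x y
    using that sp by (auto simp: top_le_def)
  show ?thesis
  proof
    assume "quot_le (subtopology T Z) (subtopology T' Z) x y"
    then have *: "(\<lambda>x y. ?R x y \<and> x \<in> Z \<and> y \<in> Z)\<^sup>+\<^sup>+ x y"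
      by (simp add: eq)
    then have "quot_le T T' x y"
      unfolding quot_le_def
      by (induction rule: tranclp_induct) (blast intro: tranclp.intros)+
    moreover have "x \<in> Z" using * by (blast dest: tranclpD)
    moreover have "y \<in> Z" using * by (cases rule: tranclp.cases) auto
    ultimately show "x \<in> Z \<and> y \<in> Z \<and> quot_le T T' x y" by blast
  next
    assume *: "x \<in> Z \<and> y \<in> Z \<and> quot_le T T' x y"
    then have R: "?R\<^sup>+\<^sup>+ x y" by (simp add: quot_le_def)
    from Z show "quot_le (subtopology T Z) (subtopology T' Z) x y"
    proof
      assume "Z = U"
      then show ?thesis
        using tranclp_restrict_closed[OF R, of Z] * closed unfolding eq by blast
    next
      assume "Z = topspace T - U"
      then have "\<And>x y. ?R x y \<Longrightarrow> y \<in> Z \<Longrightarrow> x \<in> Z"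
        using closed sub by blast
      then show ?thesis
        using tranclp_restrict_coclosed[OF R, of Z] * unfolding eq by blast
    qed
  qed
qed

lemma subtopology_top_quot:
  assumes sp: "topspace T' = topspace T"
    and U: "openin (top_quot T T') U" and Z: "Z = U \<or> Z = topspace T - U"
  shows "subtopology (top_quot T T') Z = top_quot (subtopology T Z) (subtopology T' Z)"
proof -
  have ZT: "Z \<subseteq> topspace T"
    using U Z unfolding openin_top_quot by blast
  note qs = quot_le_subtopology[OF sp U Z]
  have "openin (subtopology (top_quot T T') Z) W
      \<longleftrightarrow> openin (top_quot (subtopology T Z) (subtopology T' Z)) W" for W
  proof
    assume "openin (subtopology (top_quot T T') Z) W"
    then obtain V where "openin (top_quot T T') V" "W = V \<inter> Z"
      by (auto simp: openin_subtopology)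
    then show "openin (top_quot (subtopology T Z) (subtopology T' Z)) W"
      using ZT by (auto simp: openin_top_quot qs)
  next
    assume W: "openin (top_quot (subtopology T Z) (subtopology T' Z)) W"
    \<comment> \<open>The up-closure of \<open>W\<close> in \<open>T/T'\<close> is open there. It
      adds no point of \<open>Z\<close>, because between points of \<open>Z\<close> the order of
      \<open>T/T'\<close> is that of the quotient of the restrictions.\<close>
    let ?V = "{y. \<exists>x\<in>W. quot_le T T' x y}"
    have WZ: "W \<subseteq> Z"
      using W by (auto simp: openin_top_quot)
    have "quot_le T T' x x" if "x \<in> W" for x
      using that WZ ZT unfolding quot_le_def by (intro tranclp.r_into_trancl) (auto simp: top_le_def)
    then have "W = ?V \<inter> Z"
      using W WZ by (auto simp: openin_top_quot qs)
    moreover have "openin (top_quot T T') ?V"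
      using quot_le_topspace[OF sp] unfolding openin_top_quot
      by (auto simp: quot_le_def intro: tranclp_trans)
    ultimately show "openin (subtopology (top_quot T T') Z) W"
      by (auto simp: openin_subtopology)
  qed
  then show ?thesis by (simp add: topology_eq)
qed

text \<open>As \<open>T'\<close> is finer, each generating step of \<open>T'/T'\<close> is one of
  \<open>T/T'\<close>. Thus the restriction results for \<open>U\<close> also apply to
  \<open>T'/T'\<close>, the other quotient in the definition of admissibility.\<close>

lemma openin_top_quot_self:
  assumes "top_finer T' T" "openin (top_quot T T') U"
  shows "openin (top_quot T' T') U"
proof -
  have sp: "topspace T' = topspace T" using assms(1) by (simp add: top_finer_def)
  show ?thesis
    using assms(2) top_finer_top_le[OF assms(1)]
    unfolding openin_top_quot_step[OF sp] openin_top_quot_step[OF refl] sp by blast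
qed

text \<open>Closure under steps up in \<open>T\<close> says that \<open>U\<close> is a final segment
  of \<open>T\<close>; closure under steps down in \<open>T'\<close> says that its complement is a
  final segment of \<open>T'\<close>.\<close>

lemma openin_top_quot_iff:
  assumes fin: "finite (topspace T)" and finer: "top_finer T' T"
  shows "openin (top_quot T T') U \<longleftrightarrow> openin T U \<and> openin T' (topspace T - U)"
proof -
  have sp: "topspace T' = topspace T" using finer by (simp add: top_finer_def)
  have le: "x \<in> topspace T \<and> y \<in> topspace T" if "top_le T' x y" for x y
    using that sp by (simp add: top_le_def)
  show ?thesis
    unfolding openin_top_quot_step[OF sp] openin_iff_top_le[OF fin]
      openin_iff_top_le[of T', unfolded sp, OF fin]
    using le by blast
qed

section \<open>Admissibility on the two parts\<close>

lemma admissible_topspace: "admissible T T' \<Longrightarrow> topspace T' = topspace T"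
  by (simp add: admissible_def top_finer_def)

lemma top_equiv_same_part:
  assumes "topspace T' = topspace T" "openin (top_quot T T') U" "top_equiv (top_quot T T') x y"
  shows "x \<in> U \<longleftrightarrow> y \<in> U"
  using assms by (auto simp: top_equiv_def top_le_def)

text \<open>Both quotients commute with restriction to \<open>Z\<close>, so the condition on
  equivalences is inherited; connected subsets of the subspace \<open>Z\<close> are connected for
  \<open>T'\<close> itself.\<close>

lemma admissible_subtopology:
  assumes adm: "admissible T T'"
    and U: "openin (top_quot T T') U" and Z: "Z = U \<or> Z = topspace T - U"
  shows "admissible (subtopology T Z) (subtopology T' Z)"
proof -
  have finer: "top_finer T' T" using adm by (simp add: admissible_def)
  have sp: "topspace T' = topspace T" by (rule admissible_topspace[OF adm])
  have q1: "top_quot (subtopology T Z) (subtopology T' Z) = subtopology (top_quot T T') Z"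
    using subtopology_top_quot[OF sp U Z] by simp
  have q2: "top_quot (subtopology T' Z) (subtopology T' Z) = subtopology (top_quot T' T') Z"
    using subtopology_top_quot[OF refl openin_top_quot_self[OF finer U]] Z sp by simp
  show ?thesis
    unfolding admissible_def q1 q2 top_equiv_subtopology
  proof (intro conjI allI impI ballI)
    show "top_finer (subtopology T' Z) (subtopology T Z)"
      by (rule top_finer_subtopology[OF finer])
  next
    fix W assume "connectedin (subtopology T' Z) W"
    then have "connectedin T' W" "W \<subseteq> Z" by (auto simp: connectedin_subtopology)
    then show "subtopology (subtopology T' Z) W = subtopology (subtopology T Z) W"
      using adm by (simp add: admissible_def subtopology_subtopology Int_absorb1)
  qed (use adm in \<open>auto simp: admissible_def\<close>)
qed

text \<open>The converse: neither a \<open>T'\<close>-connected set nor an equivalence class of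
  either quotient meets both parts, so each condition is decided inside one part.\<close>

lemma admissible_glue:
  assumes finer: "top_finer T' T" and U: "openin (top_quot T T') U"
    and clopen: "openin T' U" "openin T' (topspace T - U)"
    and adm: "admissible (subtopology T U) (subtopology T' U)"
      "admissible (subtopology T (topspace T - U)) (subtopology T' (topspace T - U))"
  shows "admissible T T'"
proof -
  have sp: "topspace T' = topspace T" using finer by (simp add: top_finer_def)
  note U' = openin_top_quot_self[OF finer U]
  have admZ: "admissible (subtopology T Z) (subtopology T' Z)" if "Z = U \<or> Z = topspace T - U" for Z
    using that adm by auto
  show ?thesis
    unfolding admissible_def
  proof (intro conjI allI impI ballI)
    fix W assume W: "connectedin T' W"
    \<comment> \<open>Otherwise \<open>U\<close> and its complement, both open in \<open>T'\<close>,
      would separate the connected set \<open>W\<close>.\<close>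
    have "W \<subseteq> U \<or> W \<inter> U = {}"
    proof (rule ccontr)
      assume *: "\<not> ?thesis"
      have "W \<subseteq> topspace T" using connectedin_subset_topspace[OF W] sp by simp
      with * have "W \<subseteq> U \<union> (topspace T - U)" "U \<inter> (topspace T - U) \<inter> W = {}"
        "U \<inter> W \<noteq> {}" "(topspace T - U) \<inter> W \<noteq> {}"
        by blast+
      with W clopen show False unfolding connectedin by blast
    qed
    then have "W \<subseteq> U \<or> W \<subseteq> topspace T - U"
      using connectedin_subset_topspace[OF W] sp by blast
    then obtain Z where Z: "Z = U \<or> Z = topspace T - U" and WZ: "W \<subseteq> Z"
      by metis
    have "connectedin (subtopology T' Z) W"
      using W WZ by (simp add: connectedin_subtopology)
    then have "subtopology (subtopology T' Z) W = subtopology (subtopology T Z) W"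
      using admZ[OF Z] by (simp add: admissible_def)
    then show "subtopology T' W = subtopology T W"
      using WZ by (simp add: subtopology_subtopology Int_absorb1)
  next
    fix x y assume xy: "x \<in> topspace T" "y \<in> topspace T"
    show "top_equiv (top_quot T T') x y \<longleftrightarrow> top_equiv (top_quot T' T') x y"
    proof (cases "x \<in> U \<longleftrightarrow> y \<in> U")
      case True
      then have "x \<in> U \<and> y \<in> U \<or> x \<in> topspace T - U \<and> y \<in> topspace T - U"
        using xy by blast
      then obtain Z where Z: "Z = U \<or> Z = topspace T - U" and xyZ: "x \<in> Z" "y \<in> Z"
        by metis
      have "top_equiv (top_quot (subtopology T Z) (subtopology T' Z)) x y
          \<longleftrightarrow> top_equiv (top_quot (subtopology T' Z) (subtopology T' Z)) x y"
        using admZ[OF Z] xy xyZ by (simp add: admissible_def)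
      then show ?thesis
        using xyZ Z sp subtopology_top_quot[OF sp U Z, symmetric]
          subtopology_top_quot[OF refl U', of Z, symmetric]
        by (simp add: top_equiv_subtopology)
    next
      \<comment> \<open>Both sides are false, since \<open>U\<close> is open in both quotients and
        so contains either all or none of an equivalence class.\<close>
      case False
      then show ?thesis
        using top_equiv_same_part[OF sp U] top_equiv_same_part[OF refl U'] by blast
    qed
  qed (rule finer)
qed

section \<open>Products of topologies on disjoint sets\<close>

text \<open>By disjointness an open set of one factor has empty trace on the other, so it is already
  open in the product.\<close>

lemma subtopology_top_prod:
  assumes "topspace T1 \<inter> topspace T2 = {}"
  shows "subtopology (top_prod T1 T2) (topspace T1) = T1"
    and "subtopology (top_prod T1 T2) (topspace T2) = T2"
proof -
  have "openin (subtopology (top_prod T1 T2) (topspace T1)) W \<longleftrightarrow> openin T1 W" for W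
  proof
    assume "openin T1 W"
    then have "openin (top_prod T1 T2) W" "W = W \<inter> topspace T1"
      using openin_subset[of T1 W] assms
      by (auto simp: openin_top_prod Int_absorb2 disjoint_iff intro: back_subst[of "openin T2", OF openin_empty])
    then show "openin (subtopology (top_prod T1 T2) (topspace T1)) W"
      unfolding openin_subtopology by blast
  qed (auto simp: openin_subtopology openin_top_prod)
  then show "subtopology (top_prod T1 T2) (topspace T1) = T1" by (simp add: topology_eq)
  have "openin (subtopology (top_prod T1 T2) (topspace T2)) W \<longleftrightarrow> openin T2 W" for W
  proof
    assume "openin T2 W"
    then have "openin (top_prod T1 T2) W" "W = W \<inter> topspace T2"
      using openin_subset[of T2 W] assms
      by (auto simp: openin_top_prod Int_absorb2 disjoint_iff intro: back_subst[of "openin T1", OF openin_empty])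
    then show "openin (subtopology (top_prod T1 T2) (topspace T2)) W"
      unfolding openin_subtopology by blast
  qed (auto simp: openin_subtopology openin_top_prod)
  then show "subtopology (top_prod T1 T2) (topspace T2) = T2" by (simp add: topology_eq)
qed

text \<open>An open set is the union of its traces on the two parts, and traces open in a clopen
  part are open in \<open>T\<close>. The complement is the first factor, as in the external
  coproduct.\<close>

lemma top_prod_subtopology:
  assumes "openin T U" "openin T (topspace T - U)"
  shows "top_prod (subtopology T (topspace T - U)) (subtopology T U) = T"
proof -
  have UT: "U \<subseteq> topspace T" using assms(1) by (rule openin_subset)
  have "openin (top_prod (subtopology T (topspace T - U)) (subtopology T U)) W \<longleftrightarrow> openin T W" for W
  proof -
    have "openin T W" if "W \<subseteq> topspace T" "openin T (W \<inter> (topspace T - U))" "openin T (W \<inter> U)"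
    proof -
      have "W = (W \<inter> (topspace T - U)) \<union> (W \<inter> U)" using that(1) by blast
      then show ?thesis using openin_Un[OF that(2,3)] by simp
    qed
    then show ?thesis
      using assms UT openin_subset[of T W]
      by (auto simp: openin_top_prod openin_open_subtopology Int_absorb1)
  qed
  then show ?thesis by (simp add: topology_eq)
qed

text \<open>Collects what the inverse of the bijection needs: the product is a legal index together
  with \<open>U\<close>, and cutting it along \<open>U\<close> returns the two factors.\<close>

lemma admissible_top_prod:
  assumes fin: "finite (topspace T)" and U: "openin T U"
    and adm1: "admissible (subtopology T (topspace T - U)) T1"
    and adm2: "admissible (subtopology T U) T2"
  defines "T' \<equiv> top_prod T1 T2"
  shows "admissible T T'" "openin (top_quot T T') U"
    "subtopology T' (topspace T - U) = T1" "subtopology T' U = T2"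
proof -
  have UT: "U \<subseteq> topspace T" using U by (rule openin_subset)
  have s1: "topspace T1 = topspace T - U"
    using admissible_topspace[OF adm1] by auto
  have s2: "topspace T2 = U"
    using admissible_topspace[OF adm2] UT by auto
  show r1: "subtopology T' (topspace T - U) = T1" and r2: "subtopology T' U = T2"
    using subtopology_top_prod[of T1 T2] s1 s2 unfolding T'_def by auto
  have finer: "top_finer T' T"
    unfolding top_finer_def
  proof (intro conjI allI impI)
    show "topspace T' = topspace T" using UT s1 s2 by (auto simp: T'_def)
  next
    fix V assume V: "openin T V"
    have "openin T1 (V \<inter> (topspace T - U))"
      using adm1 V by (auto simp: admissible_def top_finer_def openin_subtopology)
    moreover have "openin T2 (V \<inter> U)"
      using adm2 V by (auto simp: admissible_def top_finer_def openin_subtopology)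
    ultimately show "openin T' V"
      using openin_subset[OF V] by (auto simp: T'_def openin_top_prod s1 s2)
  qed
  \<comment> \<open>The complement of \<open>U\<close> is the whole space of \<open>T1\<close> and
    has empty trace on \<open>U\<close>, hence is open in the product.\<close>
  have "openin T1 (topspace T - U)" using openin_topspace[of T1] by (simp add: s1)
  then have c: "openin T' (topspace T - U)"
    by (auto simp: T'_def openin_top_prod s1 s2 Diff_disjoint[of U "topspace T"] Int_commute[of _ U])
  have o: "openin T' U"
    using finer U by (simp add: top_finer_def)
  show q: "openin (top_quot T T') U"
    using U c openin_top_quot_iff[OF fin finer] by simp
  show "admissible T T'"
    using admissible_glue[OF finer q o c] adm1 adm2 by (simp add: r1 r2)
qed

section \<open>Compatibility of the coproducts\<close>

lemma finite_openin: "finite (topspace T) \<Longrightarrow> finite {U. openin T U}"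
  by (rule finite_subset[of _ "Pow (topspace T)"]) (auto dest: openin_subset)

lemma finite_admissible: "finite (topspace T) \<Longrightarrow> finite {T'. admissible T T'}"
  by (rule finite_subset[OF _ finite_topologies_on[of "topspace T"]])
     (auto simp: topologies_on_def admissible_topspace)

text \<open>Here and in the next lemma a composite is expanded into a sum of basis vectors, which
  reduces their comparison to a bijection of indices.\<close>

lemma ext_int_coprod_basis_vec:
  "tensor_map id ext_coprod (int_coprod (basis_vec T)) =
    (\<Sum>T' | admissible T T'. \<Sum>Y | openin (top_quot T T') Y.
      (basis_vec (T', subtopology (top_quot T T') (topspace T - Y), subtopology (top_quot T T') Y)
        :: _ \<Rightarrow>\<^sub>0 'k::field))"
proof -
  have "tensor (basis_vec T') (ext_coprod (basis_vec (top_quot T T'))) =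
      (\<Sum>Y | openin (top_quot T T') Y.
        (basis_vec (T', subtopology (top_quot T T') (topspace T - Y), subtopology (top_quot T T') Y)
          :: _ \<Rightarrow>\<^sub>0 'k))"
    if "admissible T T'" for T'
    by (simp add: ext_coprod_def tensor_sum_right topspace_top_quot[OF admissible_topspace[OF that]])
  then show ?thesis
    by (simp add: int_coprod_def tensor_map_def lin_extend_sum)
qed

lemma int_ext_coprod_basis_vec:
  "m13 (tensor_map int_coprod int_coprod (ext_coprod (basis_vec T))) =
    (\<Sum>Y | openin T Y. \<Sum>T1 | admissible (subtopology T (topspace T - Y)) T1.
      \<Sum>T2 | admissible (subtopology T Y) T2.
      basis_vec (top_prod T1 T2, top_quot (subtopology T (topspace T - Y)) T1,
        top_quot (subtopology T Y) T2))"
  by (simp add: int_coprod_def ext_coprod_def m13_def tensor_map_def lin_extend_sum tensor_sum)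

lemma coprods_compatible_basis_vec:
  assumes fin: "finite (topspace T)"
  shows "tensor_map id ext_coprod (int_coprod (basis_vec T)) =
    m13 (tensor_map int_coprod int_coprod (ext_coprod (basis_vec T)))"
proof -
  let ?X = "topspace T"
  let ?I = "SIGMA T':{T'. admissible T T'}. {Y. openin (top_quot T T') Y}"
  let ?J = "SIGMA Y:{Y. openin T Y}. {T1. admissible (subtopology T (?X - Y)) T1} \<times>
    {T2. admissible (subtopology T Y) T2}"
  \<comment> \<open>Merging iterated sums into one over dependent tuples, here and in
    \<open>R\<close>, requires finite index sets; they are finite because \<open>T\<close> lives on
    a finite set.\<close>
  have L: "tensor_map id ext_coprod (int_coprod (basis_vec T)) = (\<Sum>(T', Y)\<in>?I.
      basis_vec (T', subtopology (top_quot T T') (?X - Y), subtopology (top_quot T T') Y))"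
    unfolding ext_int_coprod_basis_vec
    by (rule sum.Sigma) (auto simp: fin finite_admissible topspace_top_quot admissible_topspace
        intro!: finite_openin)
  have R: "m13 (tensor_map int_coprod int_coprod (ext_coprod (basis_vec T))) = (\<Sum>(Y, T1, T2)\<in>?J.
      basis_vec (top_prod T1 T2, top_quot (subtopology T (?X - Y)) T1, top_quot (subtopology T Y) T2))"
    unfolding int_ext_coprod_basis_vec sum.cartesian_product
    by (subst sum.Sigma) (auto simp: fin finite_openin intro!: finite_cartesian_product finite_admissible)
  show ?thesis
    unfolding L R
  \<comment> \<open>\<open>j\<close> cuts \<open>T'\<close> along \<open>Y\<close>, and
    \<open>i\<close> multiplies the pieces back together while keeping \<open>Y\<close>.\<close>
  proof (rule sum.reindex_bij_witness[where
        j = "\<lambda>(T', Y). (Y, subtopology T' (?X - Y), subtopology T' Y)" and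
        i = "\<lambda>(Y, T1, T2). (top_prod T1 T2, Y)"])
    fix p assume "p \<in> ?I"
    then obtain T' Y where p: "p = (T', Y)" and adm: "admissible T T'"
      and Y: "openin (top_quot T T') Y"
      by auto
    have finer: "top_finer T' T" using adm by (simp add: admissible_def)
    note sp = admissible_topspace[OF adm]
    have oc: "openin T Y" "openin T' (?X - Y)"
      using Y openin_top_quot_iff[OF fin finer] by auto
    then have o: "openin T' Y" using finer by (simp add: top_finer_def)
    have prod: "top_prod (subtopology T' (?X - Y)) (subtopology T' Y) = T'"
      using top_prod_subtopology[of T' Y] o oc sp by simp
    show "(case (case p of (T', Y) \<Rightarrow> (Y, subtopology T' (?X - Y), subtopology T' Y)) of
        (Y, T1, T2) \<Rightarrow> (top_prod T1 T2, Y)) = p"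
      by (simp add: p prod)
    show "(case p of (T', Y) \<Rightarrow> (Y, subtopology T' (?X - Y), subtopology T' Y)) \<in> ?J"
      using oc admissible_subtopology[OF adm Y] by (simp add: p)
    \<comment> \<open>The summands agree: the first components by \<open>prod\<close>, the other two
      because quotients commute with restriction to \<open>Y\<close> and to its complement.\<close>
    show "(case (case p of (T', Y) \<Rightarrow> (Y, subtopology T' (?X - Y), subtopology T' Y)) of
        (Y, T1, T2) \<Rightarrow> basis_vec (top_prod T1 T2, top_quot (subtopology T (?X - Y)) T1,
          top_quot (subtopology T Y) T2)) =
      (case p of (T', Y) \<Rightarrow>
        basis_vec (T', subtopology (top_quot T T') (?X - Y), subtopology (top_quot T T') Y))"
      by (simp add: p prod subtopology_top_quot[OF sp Y])
  next
    fix q assume "q \<in> ?J"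
    then obtain Y T1 T2 where q: "q = (Y, T1, T2)" and "openin T Y"
      "admissible (subtopology T (?X - Y)) T1" "admissible (subtopology T Y) T2"
      by auto
    note * = admissible_top_prod[OF fin this(2-4)]
    show "(case (case q of (Y, T1, T2) \<Rightarrow> (top_prod T1 T2, Y)) of
        (T', Y) \<Rightarrow> (Y, subtopology T' (?X - Y), subtopology T' Y)) = q"
      using * by (simp add: q)
    show "(case q of (Y, T1, T2) \<Rightarrow> (top_prod T1 T2, Y)) \<in> ?I"
      using * by (simp add: q)
  qed
qed

text \<open>The summand indexed by \<open>T'\<close> and \<open>Y\<close> lies in the component of
  the direct sum belonging to the same \<open>Y\<close>.\<close>

lemma coprods_basis_vec_in_triple_sum:
  "tensor_map id ext_coprod (int_coprod (basis_vec T)) \<in> triple_sum (topspace T)"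
  unfolding ext_int_coprod_basis_vec triple_sum_def
proof (intro free_on_sum basis_vec_in_free_on)
  fix T' Y assume "T' \<in> {T'. admissible T T'}" and Y: "Y \<in> {Y. openin (top_quot T T') Y}"
  then have sp: "topspace T' = topspace T" by (simp add: admissible_topspace)
  from Y have "Y \<subseteq> topspace T" by (simp add: openin_top_quot)
  then show "(T', subtopology (top_quot T T') (topspace T - Y), subtopology (top_quot T T') Y) \<in>
      (\<Union>Y\<in>Pow (topspace T). topologies_on (topspace T) \<times> topologies_on (topspace T - Y) \<times> topologies_on Y)"
    using sp by (auto simp: topologies_on_def topspace_top_quot)
qed

theorem theorem3p5:
  fixes X :: "'a set"
  assumes "finite X"
  shows "\<forall>v \<in> (TT X :: ('a topology \<Rightarrow>\<^sub>0 'k::field) set).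
           (tensor_map id ext_coprod \<circ> int_coprod) v \<in> triple_sum X \<and>
           (tensor_map id ext_coprod \<circ> int_coprod) v
             = (m13 \<circ> tensor_map int_coprod int_coprod \<circ> ext_coprod) v"
proof
  fix v :: "'a topology \<Rightarrow>\<^sub>0 'k"
  assume "v \<in> TT X"
  then have keys: "topspace T = X" if "T \<in> Poly_Mapping.keys v" for T
    using that by (auto simp: free_on_def topologies_on_def)
  have L: "(tensor_map id ext_coprod \<circ> int_coprod) v =
      lin_extend (\<lambda>T. tensor_map id ext_coprod (int_coprod (basis_vec T))) v"
    by (simp add: tensor_map_def int_coprod_def lin_extend_lin_extend)
  have R: "(m13 \<circ> tensor_map int_coprod int_coprod \<circ> ext_coprod) v =
      lin_extend (\<lambda>T. m13 (tensor_map int_coprod int_coprod (ext_coprod (basis_vec T)))) v"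
    by (simp add: m13_def tensor_map_def ext_coprod_def lin_extend_lin_extend)
  have "(tensor_map id ext_coprod \<circ> int_coprod) v \<in> triple_sum X"
    unfolding L triple_sum_def
    by (rule free_on_lin_extend)
       (use coprods_basis_vec_in_triple_sum keys in \<open>fastforce simp: triple_sum_def\<close>)
  \<comment> \<open>Only topologies in the support of \<open>v\<close> matter; their underlying set
    is \<open>X\<close>, which supplies the finiteness needed on basis vectors.\<close>
  moreover have "(tensor_map id ext_coprod \<circ> int_coprod) v =
      (m13 \<circ> tensor_map int_coprod int_coprod \<circ> ext_coprod) v"
    unfolding L R by (rule lin_extend_cong) (simp add: coprods_compatible_basis_vec keys assms)
  ultimately show "(tensor_map id ext_coprod \<circ> int_coprod) v \<in> triple_sum X \<and>
      (tensor_map id ext_coprod \<circ> int_coprod) v =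
      (m13 \<circ> tensor_map int_coprod int_coprod \<circ> ext_coprod) v" ..
qed

end
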